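(* Let $K_0$ be any continuum. There exist compact Hausdorff spaces $K_1$, $K_2$, $K_3$ such that for each $1\leq i\leq 3$, $K_i$ is an extension of $K_{i-1}$ by continuous functions (i.e. $K_i=K_{i-1}((f^{(i)}_n)_{n\in\mathbb{N}})$ for some pairwise disjoint sequence $(f^{(i)}_n)_{n\in\mathbb{N}}$ in $C_1(K_{i-1})$), and $K_3$ is disconnected.
   Context: All spaces are Hausdorff. A continuum is a metrizable, compact, connected space. For a compact space $K$, $C_1(K)$ denotes the set of continuous functions $K\to[0,1]$; $f,g$ are disjoint if $f\cdot g=0$. For a real function $f$ on $K$, $supp(f)$ is the closure of $\{x\in K: f(x)\neq 0\}$. For a pairwise disjoint sequence $(f_n)_{n\in\mathbb{N}}$ in $C_1(K)$, let $D((f_n)_{n\in\mathbb{N}})$ be the union of all open sets $U\subseteq K$ such that $\{n: U\cap supp(f_n)\neq\emptyset\}$ is finite. The extension of $K$ by $(f_n)_{n\in\mathbb{N}}$, denoted $K((f_n)_{n\in\mathbb{N}})$, is the closure in $K\times[0,1]$ of the graph of the function $\sum_{n\in\mathbb{N}} f_n$ restricted to $D((f_n)_{n\in\mathbb{N}})$.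
   Formalization: The continuum K_0 is assumed to have at least two points; for a one-point (or empty) K_0 every extension is again one point (or empty), hence connected, so the claim fails there. *)

theory Defs
  imports "HOL-Analysis.Analysis"
begin

definition C1 :: "'a topology \<Rightarrow> ('a \<Rightarrow> real) set" where
  "C1 X = {f. continuous_map X (top_of_set {0..1}) f}"

definition continuum :: "'a topology \<Rightarrow> bool" where
  "continuum X \<longleftrightarrow> metrizable_space X \<and> Hausdorff_space X \<and> compact_space X \<and> connected_space X"

definition supp :: "'a topology \<Rightarrow> ('a \<Rightarrow> real) \<Rightarrow> 'a set" where
  "supp X f = X closure_of {x \<in> topspace X. f x \<noteq> 0}"

definition disjoint_seq_C1 :: "'a topology \<Rightarrow> (nat \<Rightarrow> 'a \<Rightarrow> real) \<Rightarrow> bool" where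
  "disjoint_seq_C1 X f \<longleftrightarrow> (\<forall>n. f n \<in> C1 X) \<and>
     (\<forall>n m. n \<noteq> m \<longrightarrow> (\<forall>x \<in> topspace X. f n x * f m x = 0))"

definition Dset :: "'a topology \<Rightarrow> (nat \<Rightarrow> 'a \<Rightarrow> real) \<Rightarrow> 'a set" where
  "Dset X f = \<Union>{U. openin X U \<and> finite {n. U \<inter> supp X (f n) \<noteq> {}}}"

definition ext_set :: "'a topology \<Rightarrow> (nat \<Rightarrow> 'a \<Rightarrow> real) \<Rightarrow> ('a \<times> real) set" where
  "ext_set X f = (prod_topology X (top_of_set {0..1})) closure_of
     {(x, \<Sum>n. f n x) | x. x \<in> Dset X f}"

definition ext_top :: "'a topology \<Rightarrow> (nat \<Rightarrow> 'a \<Rightarrow> real) \<Rightarrow> ('a \<times> real) topology" where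
  "ext_top X f = subtopology (prod_topology X (top_of_set {0..1})) (ext_set X f)"

end

theory Submission
  imports Defs
begin

text \<open>Let \<open>r\<close> be continuous on \<open>K0\<close>, with \<open>r \<le> 1\<close>, taking the value \<open>1\<close> and a negative value.
  The first extension adds up the bumps of \<open>(1 - cos (pi / r)) / 2\<close> on \<open>r > 0\<close>, and the second one
  those of \<open>max 0 (cos (pi / r))\<close>. Over \<open>r > 0\<close> the resulting coordinates \<open>s\<close>, \<open>t\<close>
  satisfy \<open>t = max 0 (1 - 2 * s)\<close>. Over \<open>r \<le> 0\<close> the sum of the second sequence vanishes, and its
  bumps accumulate at every point with \<open>0 < s < 1 / 2\<close>, so that \<open>s = 0\<close> or \<open>s \<ge> 1 / 2\<close> there.
  Hence the second extension is covered by the disjoint closed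
  sets \<open>t = max 0 (1 - 2 * s)\<close> and \<open>s = t = 0\<close>, and both are met. So two extensions already
  disconnect, and the third one is by the zero sequence.\<close>

section \<open>General facts on extensions of a space\<close>

lemma closure_of_Int_open_nonempty:
  assumes "openin X U"
  shows "U \<inter> X closure_of S \<noteq> {} \<longleftrightarrow> U \<inter> S \<noteq> {}"
  using assms by (simp add: openin_Int_closure_of_eq_empty)

lemma topspace_ext_top: "topspace (ext_top X f) = ext_set X f"
  unfolding ext_top_def ext_set_def topspace_subtopology
  using closure_of_subset_topspace by (rule inf_absorb2)

lemma ext_set_subset_topspace: "ext_set X f \<subseteq> topspace X \<times> {0..1}"
  unfolding ext_set_def using closure_of_subset_topspace by fastforce

lemma compact_space_ext_top:
  assumes "compact_space X"
  shows "compact_space (ext_top X f)"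
proof -
  have "compact_space (prod_topology X (top_of_set {0..1::real}))"
    using assms by (simp add: compact_space_prod_topology compact_space_subtopology)
  then show ?thesis
    unfolding ext_top_def ext_set_def
    by (intro compact_space_subtopology closedin_compact_space) auto
qed

lemma Hausdorff_space_ext_top:
  assumes "Hausdorff_space X"
  shows "Hausdorff_space (ext_top X f)"
  unfolding ext_top_def
  by (intro Hausdorff_space_subtopology) (simp add: assms Hausdorff_space_prod_topology Hausdorff_space_subtopology)

lemma continuous_map_fst_ext_top: "continuous_map (ext_top X f) X fst"
  unfolding ext_top_def by (simp add: continuous_map_fst continuous_map_from_subtopology)

lemma continuous_map_snd_ext_top: "continuous_map (ext_top X f) euclideanreal snd"
  unfolding ext_top_def
  by (metis continuous_map_from_subtopology continuous_map_into_fulltopology continuous_map_snd)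

lemma Dset_subset_topspace: "Dset X f \<subseteq> topspace X"
  unfolding Dset_def using openin_subset by blast

lemma suminf_in_unit_interval:
  assumes "disjoint_seq_C1 X f" "x \<in> topspace X"
  shows "(\<Sum>n. f n x) \<in> {0..1}"
proof (cases "\<exists>m. f m x \<noteq> 0")
  case True
  then obtain m where m: "f m x \<noteq> 0" by blast
  have "f n x = 0" if "n \<noteq> m" for n
    using assms that m unfolding disjoint_seq_C1_def by (metis mult_eq_0_iff)
  then have "(\<Sum>n. f n x) = f m x"
    using suminf_finite[of "{m}" "\<lambda>n. f n x"] by simp
  moreover have "f m x \<in> {0..1}"
    using assms unfolding disjoint_seq_C1_def C1_def continuous_map_in_subtopology by blast
  ultimately show ?thesis by simp
qed auto

lemma graph_subset_ext_set:
  assumes "disjoint_seq_C1 X f" "x \<in> Dset X f"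
  shows "(x, \<Sum>n. f n x) \<in> ext_set X f"
  unfolding ext_set_def
  using assms Dset_subset_topspace[of X f] suminf_in_unit_interval[OF assms(1)]
  by (intro subsetD[OF closure_of_subset]) force+

text \<open>Passes a closed condition from the graph to the whole extension; \<open>graphY\<close>
  and \<open>cover\<close> below are obtained in this way.\<close>

lemma ext_set_minimal:
  assumes "closedin (prod_topology X (top_of_set {0..1})) C"
    and "\<And>x. x \<in> Dset X f \<Longrightarrow> (x, \<Sum>n. f n x) \<in> C"
  shows "ext_set X f \<subseteq> C"
  unfolding ext_set_def using assms by (intro closure_of_minimal) auto

text \<open>Density of the graph: a point of the extension can be replaced by a nearby one whose
  second coordinate is determined by the first.\<close>

lemma ext_open_meets_graph:
  assumes "openin (ext_top X f) U" "U \<noteq> {}"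
  obtains x where "x \<in> Dset X f" "(x, \<Sum>n. f n x) \<in> U"
proof -
  let ?P = "prod_topology X (top_of_set {0..1::real})"
  let ?G = "{(x, \<Sum>n. f n x) |x. x \<in> Dset X f}"
  obtain V where V: "openin ?P V" "U = V \<inter> ext_set X f"
    using assms(1) unfolding ext_top_def openin_subtopology by auto
  have "V \<inter> ?G \<noteq> {}"
    using closure_of_Int_open_nonempty[OF V(1), of ?G] V(2) assms(2) unfolding ext_set_def by blast
  then obtain x where x: "x \<in> Dset X f" "(x, \<Sum>n. f n x) \<in> V"
    by blast
  have "(x, \<Sum>n. f n x) \<in> topspace ?P"
    using openin_subset[OF V(1)] x(2) by (rule subsetD)
  moreover have "topspace ?P \<inter> ?G \<subseteq> ext_set X f"
    unfolding ext_set_def by (rule closure_of_subset_Int)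
  moreover have "(x, \<Sum>n. f n x) \<in> ?G"
    using x(1) by auto
  ultimately have "(x, \<Sum>n. f n x) \<in> ext_set X f"
    by (metis (no_types, lifting) IntI subsetD)
  then show ?thesis using that[OF x(1)] x(2) V(2) by simp
qed

text \<open>All supports are empty, so \<open>Dset\<close> is the whole space and the first
  projection maps the extension onto \<open>X\<close>.\<close>

lemma connected_space_of_zero_extension:
  assumes "connected_space (ext_top X (\<lambda>n x. 0))"
  shows "connected_space X"
proof -
  have "topspace X \<subseteq> Dset X (\<lambda>n x. 0)"
    unfolding Dset_def supp_def by (auto intro!: exI[of _ "topspace X"])
  then have "(x, 0) \<in> ext_set X (\<lambda>n x. 0)" if "x \<in> topspace X" for x
    using graph_subset_ext_set[of X "\<lambda>n x. 0" x] that by (auto simp: disjoint_seq_C1_def C1_def)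
  then have "fst ` topspace (ext_top X (\<lambda>n x. 0)) = topspace X"
    using ext_set_subset_topspace[of X] by (force simp: topspace_ext_top)
  then show ?thesis
    using connected_space_quotient_map_image assms continuous_map_fst_ext_top
      connectedin_continuous_map_image connectedin_topspace by metis
qed

text \<open>Cut at its zeros \<open>c + 2 * n\<close>, the function \<open>\<lambda>u. w (1 / u)\<close> on the positive reals falls
  into bumps that accumulate only at \<open>0\<close>.\<close>

locale wave =
  fixes w :: "real \<Rightarrow> real" and c :: real
  assumes continuous: "continuous_on UNIV w"
    and range: "\<And>v. w v \<in> {0..1}"
    and offset: "0 \<le> c" "c \<le> 1"
    and zero: "\<And>n. w (c + 2 * real n) = 0"
begin

text \<open>The argument of \<open>w\<close> is \<open>1 / u\<close> clamped to \<open>{c + 2 * n..c + 2 * n + 2}\<close>, and is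
  \<open>c + 2 * n + 2\<close> for \<open>u \<le> 0\<close>.\<close>

definition bump :: "nat \<Rightarrow> real \<Rightarrow> real" where
  "bump n u = w (max (c + 2 * real n) (1 / max u (1 / (c + 2 * real n + 2))))"

lemma continuous_bump: "continuous_on UNIV (bump n)"
proof -
  have "max u (1 / (c + 2 * real n + 2)) \<noteq> 0" for u
    using offset(1) by (smt (verit) divide_pos_pos of_nat_0_le_iff)
  then have "continuous_on UNIV (\<lambda>u. max (c + 2 * real n) (1 / max u (1 / (c + 2 * real n + 2))))"
    by (intro continuous_intros) auto
  then show ?thesis
    unfolding bump_def by (rule continuous_on_compose2[OF continuous]) auto
qed

text \<open>Both clamp values, \<open>c + 2 * n\<close> and \<open>c + 2 * (n + 1)\<close>, are
  zeros of \<open>w\<close>, so at a nonzero value neither clamp is active.\<close>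

lemma bump_nonzero:
  assumes "bump n u \<noteq> 0"
  shows "0 < u" "c + 2 * real n < 1 / u" "1 / u < c + 2 * real n + 2"
proof -
  let ?a = "c + 2 * real n"
  have z: "w ?a = 0" "w (?a + 2) = 0"
    using zero[of n] zero[of "Suc n"] by (simp_all add: algebra_simps)
  have a: "0 \<le> ?a" using offset by simp
  have u: "u > 1 / (?a + 2)"
  proof (rule ccontr)
    assume "\<not> ?thesis"
    then have "bump n u = w (?a + 2)" using a by (simp add: bump_def max_def)
    then show False using assms z by simp
  qed
  then show u0: "0 < u" using a by (smt (verit) divide_pos_pos)
  have b: "bump n u = w (max ?a (1 / u))" using u by (simp add: bump_def max_def)
  show "?a < 1 / u"
    by (rule ccontr) (use b assms z in \<open>simp add: max_def split: if_splits\<close>)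
  show "1 / u < ?a + 2"
    using u u0 a by (simp add: field_simps)
qed

lemma bump_eq:
  assumes "0 < u" "c + 2 * real n \<le> 1 / u" "1 / u \<le> c + 2 * real n + 2"
  shows "bump n u = w (1 / u)"
proof -
  have "1 / (c + 2 * real n + 2) \<le> u"
    using assms offset by (simp add: field_simps)
  then show ?thesis using assms by (simp add: bump_def max_def)
qed

lemma bump_disjoint:
  assumes "bump n u \<noteq> 0" "bump m u \<noteq> 0"
  shows "n = m"
  using bump_nonzero[OF assms(1)] bump_nonzero[OF assms(2)] by linarith

lemma suminf_bump:
  assumes "u \<le> 1"
  shows "(\<Sum>n. bump n u) = (if 0 < u then w (1 / u) else 0)"
proof (cases "0 < u")
  case True
  \<comment> \<open>Index of the interval of length 2 that contains \<open>1 / u\<close>. Since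
    \<open>u \<le> 1\<close> gives \<open>1 / u \<ge> 1 \<ge> c\<close>, \<open>nat\<close> does not
    truncate.\<close>
  define m where "m = nat \<lfloor>(1 / u - c) / 2\<rfloor>"
  have "1 \<le> 1 / u" using True assms by simp
  then have "0 \<le> (1 / u - c) / 2" using offset by simp
  then have "real m \<le> (1 / u - c) / 2" "(1 / u - c) / 2 < real m + 1"
    unfolding m_def by linarith+
  then have m: "c + 2 * real m \<le> 1 / u" "1 / u < c + 2 * real m + 2" by simp_all
  have "bump n u = 0" if "n \<noteq> m" for n
  proof (rule ccontr)
    assume "bump n u \<noteq> 0"
    from bump_nonzero[OF this] m that show False by linarith
  qed
  then have "(\<Sum>n. bump n u) = bump m u"
    using suminf_finite[of "{m}" "\<lambda>n. bump n u"] by simp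
  then show ?thesis using bump_eq[of u m] m True by simp
next
  case False
  then have "bump n u = 0" for n using bump_nonzero(1) by blast
  then show ?thesis using False by simp
qed

lemma disjoint_seq_C1_bump:
  assumes "continuous_map X euclideanreal r"
  shows "disjoint_seq_C1 X (\<lambda>n x. bump n (r x))"
proof -
  have "continuous_map X euclideanreal (bump n \<circ> r)" for n
    by (rule continuous_map_compose[OF assms]) (simp add: continuous_bump)
  moreover have "bump n u \<in> {0..1}" for n u
    unfolding bump_def by (rule range)
  moreover have "bump n (r x) * bump m (r x) = 0" if "n \<noteq> m" for n m x
    using bump_disjoint that by (metis mult_eq_0_iff)
  ultimately show ?thesis
    unfolding disjoint_seq_C1_def C1_def continuous_map_in_subtopology o_def by blast
qed

text \<open>Near \<open>x\<close>, \<open>1 / r\<close> is bounded wherever \<open>r\<close> is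
  positive, so only finitely many bumps are nonzero there.\<close>

lemma Dset_bump:
  assumes r: "continuous_map X euclideanreal r" and x: "x \<in> topspace X" "r x \<noteq> 0"
  shows "x \<in> Dset X (\<lambda>n x. bump n (r x))"
proof -
  define e where "e = \<bar>r x\<bar> / 2"
  have e: "e > 0" using x by (simp add: e_def)
  \<comment> \<open>Avoiding the band from \<open>0\<close> to \<open>e\<close> treats both signs of
    \<open>r x\<close> at once.\<close>
  define U where "U = {y \<in> topspace X. r y \<in> - {0..e}}"
  have U: "openin X U" unfolding U_def
    by (rule openin_continuous_map_preimage[OF r]) auto
  have "{n. U \<inter> supp X (\<lambda>x. bump n (r x)) \<noteq> {}} \<subseteq> {n. real n \<le> 1 / e}"
  proof (intro subsetI CollectI)
    fix n assume "n \<in> {n. U \<inter> supp X (\<lambda>x. bump n (r x)) \<noteq> {}}"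
    then obtain y where y: "y \<in> U" "bump n (r y) \<noteq> 0"
      unfolding supp_def using closure_of_Int_open_nonempty[OF U] by auto
    from bump_nonzero[OF y(2)] y(1) have "0 < r y" "e < r y" "real n \<le> 1 / r y"
      using offset(1) by (auto simp: U_def)
    moreover have "1 / r y \<le> 1 / e" using \<open>e < r y\<close> e by (simp add: frac_le)
    ultimately show "real n \<le> 1 / e" by linarith
  qed
  moreover have "finite {n. real n \<le> 1 / e}"
    by (rule finite_subset[of _ "{..nat \<lceil>1 / e\<rceil>}"]) (auto, linarith)
  ultimately have "finite {n. U \<inter> supp X (\<lambda>x. bump n (r x)) \<noteq> {}}"
    using finite_subset by blast
  moreover have "x \<in> U" using x by (auto simp: U_def e_def)
  ultimately show ?thesis using U unfolding Dset_def by blast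
qed

end

section \<open>The two waves and the disconnected double extension\<close>

lemma wave_cos: "wave (\<lambda>v. (1 - cos (pi * v)) / 2) 0"
proof
  have "cos (pi * (0 + 2 * real n)) = 1" for n
    using cos_2npi[of n] by (simp add: mult.commute mult.left_commute)
  then show "(1 - cos (pi * (0 + 2 * real n))) / 2 = 0" for n by simp
qed (auto intro!: continuous_intros)

text \<open>The cuts are the odd integers, the midpoints between the cuts of the first wave. They
  start at \<open>1\<close>, the least value of \<open>1 / r\<close> for
  \<open>0 < r \<le> 1\<close>.\<close>

lemma wave_max_cos: "wave (\<lambda>v. max 0 (cos (pi * v))) 1"
proof
  have "cos (pi * (1 + 2 * real n)) = - 1" for n
    using cos_npi[of "1 + 2 * n"] by (simp add: mult.commute)
  then show "max 0 (cos (pi * (1 + 2 * real n))) = 0" for n by simp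
qed (auto intro!: continuous_intros)

lemma double_extension_disconnected:
  assumes r: "continuous_map X euclideanreal r"
    and r1: "\<And>x. x \<in> topspace X \<Longrightarrow> r x \<le> 1"
    and neg: "x0 \<in> topspace X" "r x0 < 0"
    and one: "y0 \<in> topspace X" "r y0 = 1"
  obtains f g where "disjoint_seq_C1 X f" "disjoint_seq_C1 (ext_top X f) g"
    "\<not> connected_space (ext_top (ext_top X f) g)"
proof -
  interpret W: wave "\<lambda>v. (1 - cos (pi * v)) / 2" 0 by (rule wave_cos)
  interpret V: wave "\<lambda>v. max 0 (cos (pi * v))" 1 by (rule wave_max_cos)
  define f where "f = (\<lambda>n x. W.bump n (r x))"
  define Y where "Y = ext_top X f"
  define g where "g = (\<lambda>n p. V.bump n (r (fst (p :: 'a \<times> real))))"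
  let ?P = "prod_topology X (top_of_set {0..1::real})"
  let ?Q = "prod_topology Y (top_of_set {0..1::real})"
  have rY: "continuous_map Y euclideanreal (\<lambda>p. r (fst p))"
    unfolding Y_def using continuous_map_compose[OF continuous_map_fst_ext_top r] by (simp add: o_def)
  have sY: "continuous_map Y euclideanreal snd"
    unfolding Y_def by (rule continuous_map_snd_ext_top)
  have topY: "topspace Y = ext_set X f" by (simp add: Y_def topspace_ext_top)
  have Ysub: "topspace Y \<subseteq> topspace X \<times> {0..1}"
    using topY ext_set_subset_topspace by metis
  have f: "disjoint_seq_C1 X f" unfolding f_def by (rule W.disjoint_seq_C1_bump[OF r])
  have g: "disjoint_seq_C1 Y g" unfolding g_def by (rule V.disjoint_seq_C1_bump[OF rY])
  have sumf: "(\<Sum>n. f n x) = (if 0 < r x then (1 - cos (pi * (1 / r x))) / 2 else 0)"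
    if "x \<in> topspace X" for x
    unfolding f_def using W.suminf_bump[OF r1[OF that]] .
  have sumg: "(\<Sum>n. g n p) = (if 0 < r (fst p) then max 0 (cos (pi * (1 / r (fst p)))) else 0)"
    if "p \<in> topspace Y" for p
    unfolding g_def by (rule V.suminf_bump) (use r1 Ysub that in auto)
  \<comment> \<open>Over \<open>r > 0\<close> the closure adds no points: \<open>Y\<close> is still
    a graph there.\<close>
  have graphY: "s = (1 - cos (pi * (1 / r x))) / 2" if "(x, s) \<in> topspace Y" "0 < r x" for x s
  proof -
    \<comment> \<open>Bounding \<open>r\<close> below by \<open>r x / 2\<close> makes the formula
      for the sum continuous on the whole product. The points where this changes it go into the
      first part of \<open>?C\<close>, which misses \<open>(x, s)\<close>.\<close>
    let ?h = "\<lambda>p. (1 - cos (pi * (1 / max (r (fst p)) (r x / 2)))) / 2"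
    let ?C = "{p \<in> topspace ?P. r (fst p) \<in> {..r x / 2}} \<union> {p \<in> topspace ?P. snd p - ?h p \<in> {0}}"
    have rP: "continuous_map ?P euclideanreal (\<lambda>p. r (fst p))"
      using continuous_map_compose[OF continuous_map_fst r] by (simp add: o_def)
    have sP: "continuous_map ?P euclideanreal snd"
      by (metis continuous_map_into_fulltopology continuous_map_snd)
    have "continuous_on UNIV (\<lambda>u. (1 - cos (pi * (1 / max u (r x / 2)))) / 2)"
      using that(2) by (intro continuous_intros) auto
    then have "continuous_map ?P euclideanreal ?h"
      using continuous_map_compose[OF rP, of euclideanreal "\<lambda>u. (1 - cos (pi * (1 / max u (r x / 2)))) / 2"]
      by (simp add: o_def)
    then have "continuous_map ?P euclideanreal (\<lambda>p. snd p - ?h p)"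
      by (intro continuous_map_diff sP)
    then have "closedin ?P ?C"
      by (intro closedin_Un closedin_continuous_map_preimage[OF rP]
          closedin_continuous_map_preimage[where Y = euclideanreal]) auto
    moreover have "(y, \<Sum>n. f n y) \<in> ?C" if y: "y \<in> Dset X f" for y
    proof -
      have yX: "y \<in> topspace X" using y Dset_subset_topspace[of X f] by blast
      then show ?thesis
        using suminf_in_unit_interval[OF f yX] sumf[OF yX] \<open>0 < r x\<close>
        by (auto simp: max_def)
    qed
    ultimately have "(x, s) \<in> ?C"
      using ext_set_minimal that(1) topY by blast
    then show ?thesis using that(2) by (auto simp: max_def)
  qed
  have notD: "(x, s) \<notin> Dset Y g" if xs: "r x \<le> 0" "0 < s" "s < 1 / 2" for x s
  proof
    assume "(x, s) \<in> Dset Y g"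
    then obtain U where U: "openin Y U" "(x, s) \<in> U" "finite {n. U \<inter> supp Y (g n) \<noteq> {}}"
      unfolding Dset_def by blast
    then obtain N where N: "\<And>n. U \<inter> supp Y (g n) \<noteq> {} \<Longrightarrow> n \<le> N"
      by (metis (mono_tags, lifting) finite_nat_set_iff_bounded_le mem_Collect_eq)
    \<comment> \<open>\<open>1 / d\<close> is the right end of the interval of bump
      \<open>N\<close>, so \<open>r < d\<close> excludes all bumps of index at most
      \<open>N\<close>.\<close>
    define d where "d = 1 / (1 + 2 * real N + 2)"
    let ?U = "U \<inter> {p \<in> topspace Y. r (fst p) \<in> {..<d}} \<inter> {p \<in> topspace Y. snd p \<in> {0<..<1/2}}"
    have "openin Y ?U"
      by (intro openin_Int U openin_continuous_map_preimage[OF rY] openin_continuous_map_preimage[OF sY]) auto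
    moreover have "0 < d" by (simp add: d_def add_pos_nonneg)
    then have "(x, s) \<in> ?U"
      using xs U openin_subset[OF U(1)] by auto
    ultimately obtain y where y: "y \<in> Dset X f" "(y, \<Sum>n. f n y) \<in> ?U"
      using ext_open_meets_graph[of X f ?U] unfolding Y_def by blast
    have yX: "y \<in> topspace X" using y(1) Dset_subset_topspace[of X f] by blast
    let ?s = "\<Sum>n. f n y"
    \<comment> \<open>The sum vanishes for \<open>r y \<le> 0\<close>, but the second coordinate is
      still positive.\<close>
    have ry: "0 < r y" "r y < d" using y(2) sumf[OF yX] by (auto split: if_splits)
    \<comment> \<open>The second coordinate is also still below \<open>1 / 2\<close>.\<close>
    have "0 < cos (pi * (1 / r y))" using y(2) sumf[OF yX] ry by auto
    then have "(\<Sum>n. g n (y, ?s)) \<noteq> 0" using sumg[of "(y, ?s)"] y(2) ry by auto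
    then obtain n where n: "g n (y, ?s) \<noteq> 0" by force
    have "(y, ?s) \<in> supp Y (g n)"
      unfolding supp_def using n y(2) by (intro subsetD[OF closure_of_subset]) auto
    then have "n \<le> N" using N y(2) by blast
    have "1 / r y < 1 + 2 * real n + 2"
      using V.bump_nonzero[of n "r y"] n by (simp add: g_def)
    moreover have "1 + 2 * real n + 2 \<le> 1 / d" using \<open>n \<le> N\<close> by (simp add: d_def)
    moreover have "1 / d < 1 / r y" using ry by (simp add: frac_less2)
    ultimately show False by linarith
  qed
  define A where "A = {q \<in> topspace ?Q. snd q - max 0 (1 - 2 * snd (fst q)) \<in> {0}}"
  define B where "B = {q \<in> topspace ?Q. snd (fst q) \<in> {0}} \<inter> {q \<in> topspace ?Q. snd q \<in> {0}}"
  have tQ: "continuous_map ?Q euclideanreal snd"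
    by (metis continuous_map_into_fulltopology continuous_map_snd)
  have sQ: "continuous_map ?Q euclideanreal (\<lambda>q. snd (fst q))"
    using continuous_map_compose[OF continuous_map_fst sY] by (simp add: o_def)
  have "continuous_on UNIV (\<lambda>u::real. max 0 (1 - 2 * u))"
    by (intro continuous_intros)
  then have "continuous_map ?Q euclideanreal (\<lambda>q. max 0 (1 - 2 * snd (fst q)))"
    using continuous_map_compose[OF sQ, of euclideanreal "\<lambda>u. max 0 (1 - 2 * u)"] by (simp add: o_def)
  then have clA: "closedin ?Q A"
    unfolding A_def
    by (intro closedin_continuous_map_preimage[where Y = euclideanreal] continuous_map_diff tQ) auto
  have clB: "closedin ?Q B"
    unfolding B_def
    by (intro closedin_Int closedin_continuous_map_preimage[OF sQ] closedin_continuous_map_preimage[OF tQ]) auto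
  \<comment> \<open>On \<open>B\<close> both coordinates are \<open>0\<close>, whereas a point of
    \<open>A\<close> with \<open>s = 0\<close> has \<open>t = 1\<close>.\<close>
  have AB: "A \<inter> B = {}" unfolding A_def B_def by auto
  have cover: "ext_set Y g \<subseteq> A \<union> B"
  proof (rule ext_set_minimal)
    show "closedin ?Q (A \<union> B)" using clA clB by (rule closedin_Un)
    fix p assume p: "p \<in> Dset Y g"
    then have pY: "p \<in> topspace Y" using p Dset_subset_topspace[of Y g] by blast
    obtain x s where xs: "p = (x, s)" by (cases p)
    have s0: "0 \<le> s" using pY Ysub xs by auto
    have Q: "(p, \<Sum>n. g n p) \<in> topspace ?Q"
      using pY suminf_in_unit_interval[OF g pY] by simp
    show "(p, \<Sum>n. g n p) \<in> A \<union> B"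
    proof (cases "0 < r x")
      case True
      then have "1 - 2 * s = cos (pi * (1 / r x))" using graphY[of x s] pY xs by simp
      then have "(p, \<Sum>n. g n p) \<in> A"
        using Q sumg[OF pY] True xs unfolding A_def by auto
      then show ?thesis by simp
    next
      case False
      then have "(\<Sum>n. g n p) = 0" using sumg[OF pY] xs by simp
      \<comment> \<open>The case \<open>s = 0\<close> leads to \<open>B\<close>. If
        \<open>s \<ge> 1 / 2\<close>, then \<open>max 0 (1 - 2 * s) = 0\<close>, which leads to
        \<open>A\<close>.\<close>
      moreover have "s = 0 \<or> 1 / 2 \<le> s" using notD[of x s] False p xs s0 by force
      ultimately show ?thesis using Q xs unfolding A_def B_def by auto
    qed
  qed
  have DY: "((x, s), \<Sum>n. g n (x, s)) \<in> ext_set Y g \<and> (x, s) \<in> topspace Y"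
    if "x \<in> topspace X" "r x \<noteq> 0" "s = (\<Sum>n. f n x)" for x s
  proof -
    have "x \<in> Dset X f" unfolding f_def by (rule W.Dset_bump[OF r]) (use that in auto)
    then have Y: "(x, s) \<in> topspace Y" using graph_subset_ext_set[OF f] topY that by simp
    then have "(x, s) \<in> Dset Y g"
      unfolding g_def using V.Dset_bump[OF rY Y] that by simp
    then show ?thesis using graph_subset_ext_set[OF g] Y by blast
  qed
  \<comment> \<open>Both sums vanish where \<open>r\<close> is negative.\<close>
  have "((x0, 0), 0) \<in> ext_set Y g"
    using DY[of x0 0] sumf[of x0] sumg[of "(x0, 0)"] neg by auto
  then have B: "ext_set Y g \<inter> B \<noteq> {}"
    using cover by (auto simp: A_def)
  \<comment> \<open>At \<open>r = 1\<close> the cosine is \<open>-1\<close>, so \<open>s = 1\<close>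
    and \<open>t = 0\<close>.\<close>
  have "((y0, 1), 0) \<in> ext_set Y g"
    using DY[of y0 1] sumf[of y0] sumg[of "(y0, 1)"] one by auto
  then have A: "ext_set Y g \<inter> A \<noteq> {}"
    using cover by (auto simp: B_def)
  have "\<not> connectedin ?Q (ext_set Y g)"
    unfolding connectedin_closedin using clA clB A B AB cover by blast
  then have "\<not> connected_space (ext_top Y g)"
    unfolding ext_top_def connectedin_def ext_set_def
    by (simp only: closure_of_subset_topspace simp_thms)
  then show thesis using that f g unfolding Y_def by blast
qed

text \<open>Two distinct points are what the Urysohn function \<open>r\<close> separates; a
  one-point space has only one-point extensions.\<close>

theorem mainTheorem5:
  fixes K0 :: "'a topology"
  assumes "continuum K0"
    and "\<exists>x y. x \<in> topspace K0 \<and> y \<in> topspace K0 \<and> x \<noteq> y"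
  shows "\<exists>(f1 :: nat \<Rightarrow> 'a \<Rightarrow> real) (f2 :: nat \<Rightarrow> 'a \<times> real \<Rightarrow> real)
            (f3 :: nat \<Rightarrow> ('a \<times> real) \<times> real \<Rightarrow> real).
           disjoint_seq_C1 K0 f1 \<and>
           disjoint_seq_C1 (ext_top K0 f1) f2 \<and>
           disjoint_seq_C1 (ext_top (ext_top K0 f1) f2) f3 \<and>
           compact_space (ext_top K0 f1) \<and> Hausdorff_space (ext_top K0 f1) \<and>
           compact_space (ext_top (ext_top K0 f1) f2) \<and>
           Hausdorff_space (ext_top (ext_top K0 f1) f2) \<and>
           compact_space (ext_top (ext_top (ext_top K0 f1) f2) f3) \<and>
           Hausdorff_space (ext_top (ext_top (ext_top K0 f1) f2) f3) \<and>
           \<not> connected_space (ext_top (ext_top (ext_top K0 f1) f2) f3)"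
proof -
  obtain x y where xy: "x \<in> topspace K0" "y \<in> topspace K0" "x \<noteq> y"
    using assms(2) by blast
  have c: "compact_space K0" and h: "Hausdorff_space K0"
    using assms(1) by (auto simp: continuum_def)
  have "closedin K0 {x}" "closedin K0 {y}"
    using h xy by (auto simp: closedin_Hausdorff_singleton)
  \<comment> \<open>The target interval provides the bound \<open>r \<le> 1\<close>, and the two
    points provide the values \<open>-1\<close> and \<open>1\<close>.\<close>
  then obtain r where r: "continuous_map K0 (top_of_set {-1..1::real}) r" "r ` {x} \<subseteq> {-1}" "r ` {y} \<subseteq> {1}"
    using Urysohn_lemma[of K0 "{x}" "{y}" "-1" 1] compact_Hausdorff_or_regular_imp_normal_space[of K0]
      c h xy by auto
  then have "continuous_map K0 euclideanreal r" "\<And>z. z \<in> topspace K0 \<Longrightarrow> r z \<le> 1"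
    by (auto simp: continuous_map_in_subtopology)
  then obtain f g where fg: "disjoint_seq_C1 K0 f" "disjoint_seq_C1 (ext_top K0 f) g"
    "\<not> connected_space (ext_top (ext_top K0 f) g)"
    using double_extension_disconnected[of K0 r x y] r xy by auto
  have "disjoint_seq_C1 (ext_top (ext_top K0 f) g) (\<lambda>n z. 0)"
    by (simp add: disjoint_seq_C1_def C1_def)
  moreover have "\<not> connected_space (ext_top (ext_top (ext_top K0 f) g) (\<lambda>n z. 0))"
    using fg(3) connected_space_of_zero_extension by blast
  ultimately show ?thesis
    using fg(1,2) by (intro exI conjI compact_space_ext_top Hausdorff_space_ext_top c h)
qed

end
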